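(* Let $X$ be a quaternionic right vector space and let $F:X\to X$ be a right-linear operator of finite rank $n$, represented as $F=\sum_{m=1}^nx_m\otimes x_m'$ with $x_m\in X$, $x_m'\in X'$, where $\{x_1,\dots,x_n\}$ is a basis of $\mathrm{Im}\,F$. If $\lambda_1,\dots,\lambda_n$ denote the standard eigenvalues of $F$, then $$T_{\mathbb H,1}(F)=2\,\mathrm{Re}\Big(\sum_{k=1}^n\lambda_k\Big),\qquad T_{\mathbb H,2}(F)=\sum_{k=1}^n|\lambda_k|^2+4\sum_{k=1}^{n-1}\sum_{\ell=k+1}^n\mathrm{Re}(\lambda_k)\,\mathrm{Re}(\lambda_\ell),$$ and $$\det{}_{\mathbb H}(I-zF)=\sum_{k=0}^{2n}(-1)^kT_{\mathbb H,k}(F)z^k=\prod_{k=1}^n\big(1-2\,\mathrm{Re}(\lambda_k)z+|\lambda_k|^2z^2\big),\qquad z\in\mathbb C.$$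
   Context: $\mathbb H$ denotes the quaternions. $X'$ is the dual of $X$ (a left $\mathbb H$-vector space of right-linear functionals), $\langle x',x\rangle=x'(x)$, and $x\otimes x'$ is the operator $v\mapsto x\langle x',v\rangle$. The matrix of $F$ is $A_F=(\langle x_i',x_j\rangle)_{i,j=1}^n\in M_n(\mathbb H)$. For $A=(a_{\ell m})\in M_n(\mathbb H)$, write $A=A_1+A_2j$ with $A_1,A_2\in M_n(\mathbb C)$; the companion matrix is $\chi_A=\begin{pmatrix}A_1&A_2\\ -\overline{A_2}&\overline{A_1}\end{pmatrix}$. Put $T_{\mathbb H,0}(A)=1$, $T_{\mathbb H,1}(A)=\mathrm{Tr}\,\chi_A=2\,\mathrm{Re}(\sum_\ell a_{\ell\ell})$, and for $k\ge2$ $$T_{\mathbb H,k}(A)=\frac1{k!}\begin{vmatrix} T_{\mathbb H,1}(A)&k-1&0&\cdots&0\\ T_{\mathbb H,1}(A^2)&T_{\mathbb H,1}(A)&k-2&\cdots&0\\ \vdots&\vdots&\ddots&\ddots&\vdots\\ T_{\mathbb H,1}(A^{k-1})&T_{\mathbb H,1}(A^{k-2})&\cdots&T_{\mathbb H,1}(A)&1\\ T_{\mathbb H,1}(A^k)&T_{\mathbb H,1}(A^{k-1})&\cdots&T_{\mathbb H,1}(A^2)&T_{\mathbb H,1}(A)\end{vmatrix}.$$ Put $\det_{\mathbb H}(I-zA)=\sum_{k=0}^{2n}(-1)^kT_{\mathbb H,k}(A)z^k$. For the operator $F$, $T_{\mathbb H,k}(F):=T_{\mathbb H,k}(A_F)$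 and $\det_{\mathbb H}(I-zF):=\det_{\mathbb H}(I-zA_F)$. The standard eigenvalues $\lambda_1,\dots,\lambda_n$ of $F$ (i.e. of $A_F$) are the representatives in $\mathbb C$ with imaginary part $\ge0$ of the similarity classes $\{s^{-1}\lambda s:s\in\mathbb H\setminus\{0\}\}$ of right eigenvalues of $A_F$, counted with multiplicity so that the eigenvalues of $\chi_{A_F}$ with algebraic multiplicity are $\lambda_1,\overline{\lambda_1},\dots,\lambda_n,\overline{\lambda_n}$. *)

theory Defs
  imports Complex_Main "Jordan_Normal_Form.Char_Poly"
begin

section \<open>Quaternions\<close>

text \<open>\<open>Quat a b c d\<close> is $a + bi + cj + dk$.\<close>

datatype quat = Quat (Re\<^sub>q: real) (Im1\<^sub>q: real) (Im2\<^sub>q: real) (Im3\<^sub>q: real)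

lemma quat_eq_iff:
  "p = q \<longleftrightarrow> Re\<^sub>q p = Re\<^sub>q q \<and> Im1\<^sub>q p = Im1\<^sub>q q \<and> Im2\<^sub>q p = Im2\<^sub>q q \<and> Im3\<^sub>q p = Im3\<^sub>q q"
  by (cases p; cases q) simp

instantiation quat :: ab_group_add
begin
definition "0 = Quat 0 0 0 0"
definition "p + q = Quat (Re\<^sub>q p + Re\<^sub>q q) (Im1\<^sub>q p + Im1\<^sub>q q) (Im2\<^sub>q p + Im2\<^sub>q q) (Im3\<^sub>q p + Im3\<^sub>q q)"
definition "- p = Quat (- Re\<^sub>q p) (- Im1\<^sub>q p) (- Im2\<^sub>q p) (- Im3\<^sub>q p)"
definition "p - q = Quat (Re\<^sub>q p - Re\<^sub>q q) (Im1\<^sub>q p - Im1\<^sub>q q) (Im2\<^sub>q p - Im2\<^sub>q q) (Im3\<^sub>q p - Im3\<^sub>q q)"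
instance
  by standard
    (auto simp: quat_eq_iff zero_quat_def plus_quat_def uminus_quat_def minus_quat_def)
end

definition quat_normsq :: "quat \<Rightarrow> real" where
  "quat_normsq q = (Re\<^sub>q q)\<^sup>2 + (Im1\<^sub>q q)\<^sup>2 + (Im2\<^sub>q q)\<^sup>2 + (Im3\<^sub>q q)\<^sup>2"

lemma quat_normsq_eq_0_iff: "quat_normsq q = 0 \<longleftrightarrow> q = 0"
  by (auto simp: quat_normsq_def quat_eq_iff zero_quat_def add_nonneg_eq_0_iff)

instantiation quat :: division_ring
begin
definition "1 = Quat 1 0 0 0"
definition "p * q = Quat
  (Re\<^sub>q p * Re\<^sub>q q - Im1\<^sub>q p * Im1\<^sub>q q - Im2\<^sub>q p * Im2\<^sub>q q - Im3\<^sub>q p * Im3\<^sub>q q)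
  (Re\<^sub>q p * Im1\<^sub>q q + Im1\<^sub>q p * Re\<^sub>q q + Im2\<^sub>q p * Im3\<^sub>q q - Im3\<^sub>q p * Im2\<^sub>q q)
  (Re\<^sub>q p * Im2\<^sub>q q - Im1\<^sub>q p * Im3\<^sub>q q + Im2\<^sub>q p * Re\<^sub>q q + Im3\<^sub>q p * Im1\<^sub>q q)
  (Re\<^sub>q p * Im3\<^sub>q q + Im1\<^sub>q p * Im2\<^sub>q q - Im2\<^sub>q p * Im1\<^sub>q q + Im3\<^sub>q p * Re\<^sub>q q)"
definition "inverse q = Quat
  (Re\<^sub>q q / quat_normsq q) (- Im1\<^sub>q q / quat_normsq q)
  (- Im2\<^sub>q q / quat_normsq q) (- Im3\<^sub>q q / quat_normsq q)"
definition "p div q = p * inverse (q :: quat)"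
instance
proof
  fix a b c :: quat
  show "a * b * c = a * (b * c)"
    by (simp add: quat_eq_iff times_quat_def algebra_simps)
  show "1 * a = a" "a * 1 = a"
    by (simp_all add: quat_eq_iff times_quat_def one_quat_def)
  show "(a + b) * c = a * c + b * c" "a * (b + c) = a * b + a * c"
    by (simp_all add: quat_eq_iff times_quat_def plus_quat_def algebra_simps)
  show "(0 :: quat) \<noteq> 1"
    by (simp add: quat_eq_iff zero_quat_def one_quat_def)
  show "inverse (0 :: quat) = 0"
    by (simp add: quat_eq_iff zero_quat_def inverse_quat_def)
  show "a div b = a * inverse b"
    by (simp add: divide_quat_def)
  assume "a \<noteq> 0"
  then have nz: "quat_normsq a \<noteq> 0"
    by (simp add: quat_normsq_eq_0_iff)
  have "(Re\<^sub>q a * Re\<^sub>q a + Im1\<^sub>q a * Im1\<^sub>q a + Im2\<^sub>q a * Im2\<^sub>q a + Im3\<^sub>q a * Im3\<^sub>q a) / quat_normsq a = 1"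
    using nz by (simp add: quat_normsq_def power2_eq_square)
  then show "inverse a * a = 1" "a * inverse a = 1"
    by (simp_all add: quat_eq_iff times_quat_def one_quat_def inverse_quat_def add_divide_distrib)
qed
end

definition quat_j :: quat where "quat_j = Quat 0 0 1 0"

definition quat_of_complex :: "complex \<Rightarrow> quat" where
  "quat_of_complex z = Quat (Re z) (Im z) 0 0"

text \<open>The components in the unique decomposition $q = z_1 + z_2 j$ with $z_1, z_2$ complex.\<close>

definition cpart1 :: "quat \<Rightarrow> complex" where "cpart1 q = Complex (Re\<^sub>q q) (Im1\<^sub>q q)"
definition cpart2 :: "quat \<Rightarrow> complex" where "cpart2 q = Complex (Im2\<^sub>q q) (Im3\<^sub>q q)"

lemma quat_cparts:
  "q = quat_of_complex z1 + quat_of_complex z2 * quat_j \<longleftrightarrow> z1 = cpart1 q \<and> z2 = cpart2 q"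
  by (auto simp: quat_eq_iff complex_eq_iff quat_of_complex_def quat_j_def cpart1_def cpart2_def
      plus_quat_def times_quat_def)

definition quat_similar :: "quat \<Rightarrow> quat \<Rightarrow> bool" where
  "quat_similar p q \<longleftrightarrow> (\<exists>s. s \<noteq> 0 \<and> q = inverse s * p * s)"


section \<open>Quaternionic right vector spaces\<close>

class quat_right_vector_space = ab_group_add +
  fixes scaleQ :: "'a \<Rightarrow> quat \<Rightarrow> 'a" (infixl "\<cdot>\<^sub>q" 75)
  assumes scaleQ_add_left: "(x + y) \<cdot>\<^sub>q a = x \<cdot>\<^sub>q a + y \<cdot>\<^sub>q a"
    and scaleQ_add_right: "x \<cdot>\<^sub>q (a + b) = x \<cdot>\<^sub>q a + x \<cdot>\<^sub>q b"
    and scaleQ_scaleQ: "x \<cdot>\<^sub>q a \<cdot>\<^sub>q b = x \<cdot>\<^sub>q (a * b)"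
    and scaleQ_one: "x \<cdot>\<^sub>q 1 = x"

instantiation quat :: quat_right_vector_space
begin
definition "scaleQ_quat p q = p * (q :: quat)"
instance
  by standard (simp_all add: scaleQ_quat_def algebra_simps)
end

definition right_linear :: "('a::quat_right_vector_space \<Rightarrow> 'b::quat_right_vector_space) \<Rightarrow> bool" where
  "right_linear f \<longleftrightarrow> (\<forall>x y. f (x + y) = f x + f y) \<and> (\<forall>x a. f (x \<cdot>\<^sub>q a) = f x \<cdot>\<^sub>q a)"

definition dual :: "('a::quat_right_vector_space \<Rightarrow> quat) set" where
  "dual = {f. right_linear f}"

definition rank_one :: "'a::quat_right_vector_space \<Rightarrow> ('a \<Rightarrow> quat) \<Rightarrow> 'a \<Rightarrow> 'a" (infix "\<otimes>\<^sub>q" 80) where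
  "(x \<otimes>\<^sub>q x') v = x \<cdot>\<^sub>q x' v"

text \<open>\<open>x 0, \<dots>, x (n - 1)\<close> is a basis of the right subspace \<open>V\<close>.\<close>

definition right_basis :: "nat \<Rightarrow> (nat \<Rightarrow> 'a::quat_right_vector_space) \<Rightarrow> 'a set \<Rightarrow> bool" where
  "right_basis n x V \<longleftrightarrow>
     (\<forall>c. (\<Sum>m<n. x m \<cdot>\<^sub>q c m) = 0 \<longrightarrow> (\<forall>m<n. c m = 0)) \<and>
     V = {\<Sum>m<n. x m \<cdot>\<^sub>q c m | c. True}"

definition has_rank :: "('a::quat_right_vector_space \<Rightarrow> 'a) \<Rightarrow> nat \<Rightarrow> bool" where
  "has_rank F n \<longleftrightarrow> (\<exists>b. right_basis n b (range F))"

text \<open>The matrix $A_F$ of $F = \sum_m x_m \otimes x_m'$; rows and columns are indexed from 0.\<close>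

definition op_matrix :: "nat \<Rightarrow> (nat \<Rightarrow> 'a) \<Rightarrow> (nat \<Rightarrow> 'a \<Rightarrow> quat) \<Rightarrow> quat mat" where
  "op_matrix n x x' = mat n n (\<lambda>(i, j). x' i (x j))"


section \<open>Companion matrix, traces and determinant\<close>

definition companion :: "quat mat \<Rightarrow> complex mat" where
  "companion A = four_block_mat
     (map_mat cpart1 A) (map_mat cpart2 A)
     (- map_mat cnj (map_mat cpart2 A)) (map_mat cnj (map_mat cpart1 A))"

definition mat_trace :: "'a::comm_monoid_add mat \<Rightarrow> 'a" where
  "mat_trace A = (\<Sum>i<dim_row A. A $$ (i, i))"

definition TH1 :: "quat mat \<Rightarrow> complex" where
  "TH1 A = mat_trace (companion A)"

lemma TH1_eq:
  assumes "A \<in> carrier_mat n n"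
  shows "TH1 A = complex_of_real (2 * Re\<^sub>q (\<Sum>l<n. A $$ (l, l)))"
proof -
  have Req_sum: "Re\<^sub>q (sum f S) = (\<Sum>i\<in>S. Re\<^sub>q (f i))" for f and S :: "nat set"
    by (induction S rule: infinite_finite_induct) (simp_all add: zero_quat_def plus_quat_def)
  have split: "(\<Sum>i<n + k. f i) = (\<Sum>i<n. f i) + (\<Sum>i<k. f (n + i))"
    for f :: "nat \<Rightarrow> complex" and k
    by (induction k) (simp_all add: add.assoc)
  have "TH1 A = (\<Sum>i<n + n. companion A $$ (i, i))"
    using assms by (simp add: TH1_def mat_trace_def companion_def)
  also have "\<dots> = (\<Sum>i<n. companion A $$ (i, i)) + (\<Sum>i<n. companion A $$ (n + i, n + i))"
    by (rule split)
  also have "\<dots> = (\<Sum>i<n. cpart1 (A $$ (i, i)) + cnj (cpart1 (A $$ (i, i))))"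
    using assms by (simp add: companion_def sum.distrib)
  also have "\<dots> = (\<Sum>i<n. complex_of_real (2 * Re\<^sub>q (A $$ (i, i))))"
    by (intro sum.cong) (simp_all add: cpart1_def complex_eq_iff)
  finally show ?thesis
    by (simp add: Req_sum sum_distrib_left)
qed

text \<open>With 0-based indices, the $k \times k$ matrix defining $T_{\mathbb H,k}(A)$ for $k \ge 2$ has
  entries $T_{\mathbb H,1}(A^{i-j+1})$ on and below the diagonal and superdiagonal
  $k-1, k-2, \dots, 1$.\<close>

definition TH :: "nat \<Rightarrow> quat mat \<Rightarrow> complex" where
  "TH k A =
     (if k = 0 then 1 else if k = 1 then TH1 A
      else 1 / fact k * det (mat k k (\<lambda>(i, j).
        if j \<le> i then TH1 (A ^\<^sub>m (i - j + 1))
        else if j = i + 1 then of_nat (k - 1 - i)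
        else 0)))"

text \<open>$\det_{\mathbb H}(I - zA)$\<close>

definition detH :: "complex \<Rightarrow> quat mat \<Rightarrow> complex" where
  "detH z A = (\<Sum>k = 0..2 * dim_row A. (-1) ^ k * TH k A * z ^ k)"


section \<open>Standard eigenvalues\<close>

definition right_eigenvalue :: "quat mat \<Rightarrow> quat \<Rightarrow> bool" where
  "right_eigenvalue A q \<longleftrightarrow>
     (\<exists>v \<in> carrier_vec (dim_row A). v \<noteq> 0\<^sub>v (dim_row A) \<and> A *\<^sub>v v = map_vec (\<lambda>a. a * q) v)"

text \<open>\<open>ev 0, \<dots>, ev (n - 1)\<close> are the representatives, in the closed upper half plane, of the
  similarity classes of right eigenvalues, repeated so that the \<open>ev k\<close> together with their
  conjugates are the eigenvalues of the companion matrix with algebraic multiplicity.\<close>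

definition standard_eigenvalues :: "nat \<Rightarrow> quat mat \<Rightarrow> (nat \<Rightarrow> complex) \<Rightarrow> bool" where
  "standard_eigenvalues n A ev \<longleftrightarrow>
     (\<forall>k<n. 0 \<le> Im (ev k)) \<and>
     (\<forall>q. right_eigenvalue A q \<longleftrightarrow> (\<exists>k<n. quat_similar (quat_of_complex (ev k)) q)) \<and>
     proots (char_poly (companion A)) = (\<Sum>k<n. {#ev k, cnj (ev k)#})"

end

theory Submission
  imports Defs "Jordan_Normal_Form.Schur_Decomposition"
    "HOL-Computational_Algebra.Polynomial_FPS"
begin

text \<open>The numbers $T_{\mathbb H,k}(A)$ are the elementary symmetric polynomials of the $2n$
  eigenvalues $\mu$ of $\chi_A$, and the determinant that defines them is Newton's formula
  expressing elementary symmetric polynomials through power sums. Three facts carry the proof.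

  The map $A \mapsto \chi_A$ is multiplicative (\<open>companion_pow\<close>), so the entries
  $T_{\mathbb H,1}(A^m)$ of the determinant equal $\mathrm{Tr}(\chi_A^m)$. By Schur
  triangularisation this is the power sum $p_m = \sum \mu^m$ (\<open>mat_trace_pow\<close>).

  Expanding the determinant gives Newton's recurrence
  $k\,T_k = \sum_{i=1}^{k} (-1)^{i-1} p_i T_{k-i}$ (\<open>newton_coeff_rec\<close>). The coefficients of
  $\prod(1-\mu z)$ satisfy the same recurrence up to the sign $(-1)^k$, as its logarithmic
  derivative is $-\sum_m p_{m+1} z^m$ (\<open>fps_deriv_prod_linear\<close>). Hence
  $\sum_k (-1)^k T_k z^k = \prod(1-\mu z)$ (\<open>newton_coeff_eq_coeff\<close>).

  The $\mu$ come in pairs $\lambda_k, \overline{\lambda_k}$, and each pair contributes the factor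
  $1 - 2\,\mathrm{Re}(\lambda_k) z + |\lambda_k|^2 z^2$. The values of $T_1$ and $T_2$ are the first
  two steps of the recurrence, $T_1 = p_1$ and $2T_2 = p_1^2 - p_2$.\<close>

section \<open>Multiplicativity of the companion matrix\<close>

lemma cpart_zero [simp]: "cpart1 0 = 0" "cpart2 0 = 0"
  by (simp_all add: cpart1_def cpart2_def zero_quat_def complex_eq_iff)

lemma cpart_one [simp]: "cpart1 1 = 1" "cpart2 1 = 0"
  by (simp_all add: cpart1_def cpart2_def one_quat_def complex_eq_iff)

lemma cpart_add: "cpart1 (p + q) = cpart1 p + cpart1 q" "cpart2 (p + q) = cpart2 p + cpart2 q"
  by (simp_all add: cpart1_def cpart2_def plus_quat_def complex_eq_iff)

lemma cpart_sum: "cpart1 (sum f S) = (\<Sum>i\<in>S. cpart1 (f i))" "cpart2 (sum f S) = (\<Sum>i\<in>S. cpart2 (f i))"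
  by (induction S rule: infinite_finite_induct) (simp_all add: cpart_add)

text \<open>These formulas come from $jz = \overline z j$ for complex $z$, and $j^2 = -1$.\<close>

lemma cpart_mult:
  "cpart1 (p * q) = cpart1 p * cpart1 q - cpart2 p * cnj (cpart2 q)"
  "cpart2 (p * q) = cpart1 p * cpart2 q + cpart2 p * cnj (cpart1 q)"
  by (simp_all add: cpart1_def cpart2_def times_quat_def complex_eq_iff)

lemma companion_carrier [simp]:
  "A \<in> carrier_mat n n \<Longrightarrow> companion A \<in> carrier_mat (n + n) (n + n)"
  by (auto simp: companion_def)

lemma companion_one: "companion (1\<^sub>m n) = 1\<^sub>m (n + n)"
  by (rule eq_matI) (auto simp: companion_def)

lemma companion_mult:
  assumes A: "A \<in> carrier_mat n n" and B: "B \<in> carrier_mat n n"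
  shows "companion (A * B) = companion A * companion B"
proof -
  have "companion A * companion B = four_block_mat
     (map_mat cpart1 A * map_mat cpart1 B + map_mat cpart2 A * (- map_mat cnj (map_mat cpart2 B)))
     (map_mat cpart1 A * map_mat cpart2 B + map_mat cpart2 A * map_mat cnj (map_mat cpart1 B))
     (- map_mat cnj (map_mat cpart2 A) * map_mat cpart1 B
        + map_mat cnj (map_mat cpart1 A) * (- map_mat cnj (map_mat cpart2 B)))
     (- map_mat cnj (map_mat cpart2 A) * map_mat cpart2 B
        + map_mat cnj (map_mat cpart1 A) * map_mat cnj (map_mat cpart1 B))"
    unfolding companion_def by (rule mult_four_block_mat) (use A B in auto)
  also have "\<dots> = companion (A * B)"
    unfolding companion_def
    by (intro arg_cong4[of _ _ _ _ _ _ _ _ four_block_mat]; rule eq_matI)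
      (use A B in \<open>auto simp: scalar_prod_def cpart_sum cpart_mult sum.distrib sum_negf
        sum_subtractf algebra_simps\<close>)
  finally show ?thesis ..
qed

lemma companion_pow:
  assumes "A \<in> carrier_mat n n"
  shows "companion (A ^\<^sub>m m) = companion A ^\<^sub>m m"
proof (induction m)
  case 0
  then show ?case using assms carrier_matD(1)[OF companion_carrier[OF assms]]
    by (simp add: companion_one)
next
  case (Suc m)
  then show ?case using assms by (simp add: companion_mult[of _ n])
qed

section \<open>Traces of powers as power sums of eigenvalues\<close>

lemma mat_trace_mult_commute:
  fixes A B :: "'a::comm_semiring_0 mat"
  assumes "A \<in> carrier_mat n n" "B \<in> carrier_mat n n"
  shows "mat_trace (A * B) = mat_trace (B * A)"
proof -
  have "mat_trace (A * B) = (\<Sum>i<n. \<Sum>j<n. A $$ (i, j) * B $$ (j, i))"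
    using assms by (simp add: mat_trace_def scalar_prod_def atLeast0LessThan)
  also have "\<dots> = (\<Sum>j<n. \<Sum>i<n. B $$ (j, i) * A $$ (i, j))"
    by (subst sum.swap) (simp add: mult.commute)
  also have "\<dots> = mat_trace (B * A)"
    using assms by (simp add: mat_trace_def scalar_prod_def atLeast0LessThan)
  finally show ?thesis .
qed

lemma mat_trace_similar:
  fixes A :: "'a::comm_semiring_1 mat"
  assumes wit: "similar_mat_wit A B P Q"
  shows "mat_trace A = mat_trace B"
proof -
  define n where "n = dim_row A"
  note D = similar_mat_witD[OF n_def wit]
  have "mat_trace A = mat_trace (P * (B * Q))"
    using D by (simp add: assoc_mult_mat)
  also have "\<dots> = mat_trace (B * Q * P)"
    by (rule mat_trace_mult_commute) (use D in auto)
  also have "B * Q * P = B * (Q * P)"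
    by (rule assoc_mult_mat) (use D in auto)
  finally show ?thesis
    using D by simp
qed

lemma upper_triangular_mult:
  fixes A B :: "'a::semiring_0 mat"
  assumes A: "A \<in> carrier_mat n n" "upper_triangular A"
    and B: "B \<in> carrier_mat n n" "upper_triangular B"
  shows "upper_triangular (A * B)"
    and "i < n \<Longrightarrow> (A * B) $$ (i, i) = A $$ (i, i) * B $$ (i, i)"
proof -
  have entry: "(A * B) $$ (i, j) = (\<Sum>k<n. A $$ (i, k) * B $$ (k, j))" if "i < n" "j < n" for i j
    using A B that by (simp add: scalar_prod_def atLeast0LessThan)
  have zero: "A $$ (i, k) * B $$ (k, j) = 0" if "i < n" "k < n" "j \<le> i" "k \<noteq> i \<or> j < i" for i j k
  proof (cases "k < i")
    case True
    then have "A $$ (i, k) = 0" using A that by (intro upper_triangularD[OF A(2)]) auto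
    then show ?thesis by simp
  next
    case False
    then have "j < k" using that by auto
    then have "B $$ (k, j) = 0" using B that by (intro upper_triangularD[OF B(2)]) auto
    then show ?thesis by simp
  qed
  show "upper_triangular (A * B)"
  proof (rule upper_triangularI)
    fix i j assume "j < i" "i < dim_row (A * B)"
    then show "(A * B) $$ (i, j) = 0"
      using A by (simp add: entry zero)
  qed
  show "(A * B) $$ (i, i) = A $$ (i, i) * B $$ (i, i)" if "i < n"
  proof -
    have "(A * B) $$ (i, i) = (\<Sum>k<n. if k = i then A $$ (i, i) * B $$ (i, i) else 0)"
      unfolding entry[OF that that] by (rule sum.cong) (auto simp: zero that)
    then show ?thesis using that by simp
  qed
qed

lemma upper_triangular_pow:
  fixes A :: "'a::semiring_1 mat"
  assumes A: "A \<in> carrier_mat n n" "upper_triangular A"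
  shows "upper_triangular (A ^\<^sub>m m) \<and> (\<forall>i<n. (A ^\<^sub>m m) $$ (i, i) = (A $$ (i, i)) ^ m)"
proof (induction m)
  case 0
  then show ?case using A by simp
next
  case (Suc m)
  have "A ^\<^sub>m m \<in> carrier_mat n n" using A by simp
  then show ?case
    using Suc A upper_triangular_mult[of "A ^\<^sub>m m" n A] by (auto simp: power_commutes)
qed

text \<open>A Schur form of \<open>A\<close> has the eigenvalues with multiplicity on its diagonal, and powers of
  triangular matrices act entrywise on the diagonal.\<close>

lemma mat_trace_pow:
  fixes A :: "complex mat"
  assumes A: "A \<in> carrier_mat n n"
  shows "mat_trace (A ^\<^sub>m m) = (\<Sum>\<mu>\<in>#proots (char_poly A). \<mu> ^ m)"
proof -
  obtain es where es: "char_poly A = (\<Prod>e\<leftarrow>es. [:- e, 1:])"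
    using char_poly_factorized[OF A] by blast
  have roots: "proots (char_poly A) = mset es"
    unfolding es
  proof (induction es)
    case (Cons e es)
    have "(\<Prod>e\<leftarrow>es. [:- e, 1:]) \<noteq> 0"
      by (auto simp: prod_list_zero_iff)
    then have "proots ([:- e, 1:] * (\<Prod>e\<leftarrow>es. [:- e, 1:])) = {#e#} + mset es"
      using Cons by (subst proots_mult) auto
    then show ?case by simp
  qed simp
  obtain B P Q where "schur_decomposition A es = (B, P, Q)"
    by (cases "schur_decomposition A es") auto
  from schur_decomposition[OF A es this]
  have wit: "similar_mat_wit A B P Q" and ut: "upper_triangular B" and diag: "diag_mat B = es"
    by auto
  have B: "B \<in> carrier_mat n n"
    by (rule similar_mat_witD(5)[OF carrier_matD(1)[OF A, symmetric] wit])
  have "mat_trace (A ^\<^sub>m m) = mat_trace (B ^\<^sub>m m)"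
    by (rule mat_trace_similar[OF similar_mat_wit_pow[OF wit]])
  also have "\<dots> = (\<Sum>i<n. (B $$ (i, i)) ^ m)"
    using upper_triangular_pow[OF B ut, of m] B by (simp add: mat_trace_def)
  also have "\<dots> = (\<Sum>e\<leftarrow>diag_mat B. e ^ m)"
    using B by (simp add: diag_mat_def o_def atLeast0LessThan interv_sum_list_conv_sum_set_nat)
  also have "\<dots> = (\<Sum>\<mu>\<in>#mset es. \<mu> ^ m)"
    by (simp add: diag flip: sum_mset_sum_list)
  finally show ?thesis
    by (simp add: roots)
qed

section \<open>Newton's recurrence for the determinant\<close>

definition newton_entry :: "(nat \<Rightarrow> 'a::comm_ring_1) \<Rightarrow> nat \<Rightarrow> nat \<Rightarrow> nat \<Rightarrow> 'a" where
  "newton_entry p k i j =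
     (if j \<le> i then p (i - j + 1) else if j = i + 1 then of_nat (k - 1 - i) else 0)"

definition newton_mat :: "(nat \<Rightarrow> 'a::comm_ring_1) \<Rightarrow> nat \<Rightarrow> 'a mat" where
  "newton_mat p k = mat k k (\<lambda>(i, j). newton_entry p k i j)"

definition newton_coeff :: "(nat \<Rightarrow> 'a::field_char_0) \<Rightarrow> nat \<Rightarrow> 'a" where
  "newton_coeff p k = det (newton_mat p k) / fact k"

text \<open>The Newton matrix with its first column replaced by an arbitrary one. Deleting the first row
  and the second column of a Newton matrix keeps the tail of the first column next to a smaller
  Newton matrix, so this is the shape that is closed under expansion along the first row.\<close>

definition newton_col_mat :: "(nat \<Rightarrow> 'a::comm_ring_1) \<Rightarrow> (nat \<Rightarrow> 'a) \<Rightarrow> nat \<Rightarrow> 'a mat" where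
  "newton_col_mat c p k = mat k k (\<lambda>(i, j). if j = 0 then c i else newton_entry p k i j)"

lemma newton_entry_Suc: "newton_entry p (Suc k) (Suc i) (Suc j) = newton_entry p k i j"
  by (simp add: newton_entry_def)

text \<open>The first row is $(c_0, k, 0, \dots, 0)$, so at most two minors survive. For $k = 0$ there is
  no second column, and the factor $k$ removes the second term.\<close>

lemma det_newton_col_mat_Suc:
  "det (newton_col_mat c p (Suc k)) =
     c 0 * det (newton_mat p k) - of_nat k * det (newton_col_mat (c \<circ> Suc) p k)"
proof -
  let ?M = "newton_col_mat c p (Suc k)"
  have M: "?M \<in> carrier_mat (Suc k) (Suc k)"
    by (simp add: newton_col_mat_def)
  have minor0: "mat_delete ?M 0 0 = newton_mat p k"
    by (rule eq_matI)
      (auto simp: mat_delete_def newton_col_mat_def newton_mat_def newton_entry_Suc)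
  have "det ?M = (\<Sum>j<Suc k. ?M $$ (0, j) * cofactor ?M 0 j)"
    by (rule laplace_expansion_row[OF M]) simp
  also have "\<dots> = c 0 * det (newton_mat p k) + (\<Sum>j<k. ?M $$ (0, Suc j) * cofactor ?M 0 (Suc j))"
    unfolding sum.lessThan_Suc_shift
    by (simp add: cofactor_def minor0) (simp add: newton_col_mat_def)
  also have "(\<Sum>j<k. ?M $$ (0, Suc j) * cofactor ?M 0 (Suc j)) =
      - (of_nat k * det (newton_col_mat (c \<circ> Suc) p k))"
  proof (cases k)
    case 0
    then show ?thesis by simp
  next
    case (Suc l)
    have minor1: "mat_delete ?M 0 (Suc 0) = newton_col_mat (c \<circ> Suc) p k"
      by (rule eq_matI)
        (auto simp: mat_delete_def newton_col_mat_def newton_entry_Suc less_Suc_eq_0_disj)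
    have "(\<Sum>j<k. ?M $$ (0, Suc j) * cofactor ?M 0 (Suc j)) =
        (\<Sum>j<k. if j = 0 then of_nat k * cofactor ?M 0 (Suc 0) else 0)"
      by (rule sum.cong) (auto simp: newton_col_mat_def newton_entry_def)
    also have "\<dots> = of_nat k * cofactor ?M 0 (Suc 0)"
      using Suc by simp
    finally show ?thesis
      by (simp add: cofactor_def minor1)
  qed
  finally show ?thesis by simp
qed

text \<open>Dividing by $k!$ absorbs the superdiagonal factors $k, k-1, \dots, 1$ that iterating the
  expansion picks up. What remains is an alternating convolution of the first column with the
  normalised smaller determinants.\<close>

lemma det_newton_col_mat:
  fixes p :: "nat \<Rightarrow> 'a::field_char_0"
  shows "det (newton_col_mat c p (Suc k)) / fact k =
    (\<Sum>i\<le>k. (- 1) ^ i * c i * newton_coeff p (k - i))"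
proof (induction k arbitrary: c)
  case 0
  then show ?case by (simp add: det_newton_col_mat_Suc newton_coeff_def)
next
  case (Suc k)
  have "det (newton_col_mat c p (Suc (Suc k))) / fact (Suc k) =
      c 0 * newton_coeff p (Suc k) - det (newton_col_mat (c \<circ> Suc) p (Suc k)) / fact k"
    by (subst det_newton_col_mat_Suc)
      (simp add: newton_coeff_def diff_divide_distrib del: of_nat_Suc)
  also have "\<dots> = (\<Sum>i\<le>Suc k. (- 1) ^ i * c i * newton_coeff p (Suc k - i))"
    unfolding Suc.IH by (subst sum.atMost_Suc_shift) (simp add: sum_negf)
  finally show ?case .
qed

lemma newton_coeff_0 [simp]: "newton_coeff p 0 = 1"
  by (simp add: newton_coeff_def newton_mat_def)

text \<open>A Newton matrix is its own generalisation with first column $p_1, p_2, \dots$\<close>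

lemma newton_coeff_rec:
  "of_nat (Suc k) * newton_coeff p (Suc k) =
     (\<Sum>i\<le>k. (- 1) ^ i * p (Suc i) * newton_coeff p (k - i))"
proof -
  have "newton_mat p (Suc k) = newton_col_mat (p \<circ> Suc) p (Suc k)"
    by (rule eq_matI) (auto simp: newton_mat_def newton_col_mat_def newton_entry_def)
  then have "of_nat (Suc k) * newton_coeff p (Suc k) =
      det (newton_col_mat (p \<circ> Suc) p (Suc k)) / fact k"
    by (simp add: newton_coeff_def del: of_nat_Suc)
  then show ?thesis
    by (simp add: det_newton_col_mat)
qed

lemma newton_coeff_1: "newton_coeff p 1 = p 1"
  using newton_coeff_rec[of 0 p] by simp

lemma newton_coeff_2: "2 * newton_coeff p 2 = (p 1)\<^sup>2 - p 2"
  using newton_coeff_rec[of 1 p] newton_coeff_1[of p] by (simp add: power2_eq_square numeral_2_eq_2)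

section \<open>Newton's recurrence for the coefficients of a product of linear factors\<close>

definition power_sum :: "'a::comm_semiring_1 multiset \<Rightarrow> nat \<Rightarrow> 'a" where
  "power_sum M m = (\<Sum>\<mu>\<in>#M. \<mu> ^ m)"

text \<open>Each factor $1 - \mu X$ has logarithmic derivative
  $-\mu/(1 - \mu X) = -\sum_m \mu^{m+1} X^m$.\<close>

lemma fps_deriv_prod_linear:
  fixes M :: "'a::field multiset"
  defines "P \<equiv> fps_of_poly (\<Prod>\<mu>\<in>#M. [:1, - \<mu>:])"
  shows "fps_deriv P = - (Abs_fps (\<lambda>m. power_sum M (Suc m)) * P)"
  unfolding P_def
proof (induction M)
  case empty
  then show ?case by (simp add: power_sum_def fps_eq_iff)
next
  case (add \<mu> M)
  define Q where "Q = fps_of_poly (\<Prod>\<mu>\<in>#M. [:1, - \<mu>:])"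
  define L where "L = fps_of_poly [:1, - \<mu>:]"
  define S where "S = Abs_fps (\<lambda>m. power_sum M (Suc m))"
  define G where "G = Abs_fps (\<lambda>m. \<mu> ^ Suc m)"
  have L: "L = 1 - fps_const \<mu> * fps_X"
    by (simp add: L_def fps_of_poly_linear' flip: fps_const_neg)
  have GL: "G * L = fps_const \<mu>"
  proof (rule fps_ext)
    fix m
    have "G * L = G - fps_X * (fps_const \<mu> * G)"
      by (simp add: L algebra_simps)
    then show "fps_nth (G * L) m = fps_nth (fps_const \<mu>) m"
      by (cases m) (simp_all add: G_def)
  qed
  have dL: "fps_deriv L = - fps_const \<mu>"
    by (simp add: L)
  have SG: "Abs_fps (\<lambda>m. power_sum (add_mset \<mu> M) (Suc m)) = S + G"
    by (simp add: fps_eq_iff S_def G_def power_sum_def add.commute)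
  have prod: "fps_of_poly (\<Prod>\<mu>\<in>#add_mset \<mu> M. [:1, - \<mu>:]) = L * Q"
    by (simp add: L_def Q_def fps_of_poly_mult del: mult_pCons_left)
  have "fps_deriv (L * Q) = fps_deriv L * Q + L * fps_deriv Q"
    by (simp add: algebra_simps)
  also have "\<dots> = - (G * L) * Q - L * (S * Q)"
    using add by (simp add: dL GL Q_def S_def)
  also have "\<dots> = - ((S + G) * (L * Q))"
    by (simp add: algebra_simps)
  finally show ?case
    by (simp only: prod SG)
qed

text \<open>Comparing coefficients of $X^l$ in the differential equation for \<open>P\<close> gives
  $(l+1)\,c_{l+1} = -\sum_i p_{i+1} c_{l-i}$, which becomes Newton's recurrence after the
  substitution $c_k = (-1)^k T_k$. Characteristic zero allows the division by $l + 1$.\<close>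

lemma newton_coeff_eq_coeff:
  fixes M :: "'a::field_char_0 multiset"
  shows "(- 1) ^ k * newton_coeff (power_sum M) k = coeff (\<Prod>\<mu>\<in>#M. [:1, - \<mu>:]) k"
proof (induction k rule: less_induct)
  case (less k)
  define P where "P = (\<Prod>\<mu>\<in>#M. [:1, - \<mu>:])"
  show ?case
  proof (cases k)
    case 0
    have "coeff P 0 = (\<Prod>\<mu>\<in>#M. 1)"
      unfolding P_def by (induction M) (simp_all add: coeff_mult)
    then show ?thesis using 0 by (simp add: P_def)
  next
    case (Suc l)
    have "of_nat (Suc l) * coeff P (Suc l) = fps_nth (fps_deriv (fps_of_poly P)) l"
      by simp
    also have "\<dots> = - (\<Sum>i\<le>l. power_sum M (Suc i) * coeff P (l - i))"
      unfolding P_def fps_deriv_prod_linear by (simp add: fps_mult_nth atLeast0AtMost)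
    also have "\<dots> = - (\<Sum>i\<le>l. power_sum M (Suc i)
        * ((- 1) ^ (l - i) * newton_coeff (power_sum M) (l - i)))"
      using less Suc by (simp add: P_def)
    also have "\<dots> = - (\<Sum>i\<le>l. (- 1) ^ l *
        ((- 1) ^ i * power_sum M (Suc i) * newton_coeff (power_sum M) (l - i)))"
      by (intro arg_cong[where f = uminus] sum.cong)
        (auto simp: minus_one_power_iff)
    also have "\<dots> = (- 1) ^ Suc l * (of_nat (Suc l) * newton_coeff (power_sum M) (Suc l))"
      unfolding newton_coeff_rec by (simp add: sum_distrib_left sum_negf)
    finally have "of_nat (Suc l) * coeff P (Suc l) =
        of_nat (Suc l) * ((- 1) ^ Suc l * newton_coeff (power_sum M) (Suc l))"
      by (simp only: mult.left_commute)
    then have "coeff P (Suc l) = (- 1) ^ Suc l * newton_coeff (power_sum M) (Suc l)"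
      by (metis mult_cancel_left of_nat_neq_0)
    then show ?thesis using Suc by (simp add: P_def)
  qed
qed

lemma sum_newton_coeff:
  fixes M :: "'a::field_char_0 multiset"
  shows "(\<Sum>k\<le>size M. (- 1) ^ k * newton_coeff (power_sum M) k * z ^ k) = (\<Prod>\<mu>\<in>#M. 1 - \<mu> * z)"
proof -
  define P where "P = (\<Prod>\<mu>\<in>#M. [:1, - \<mu>:])"
  have "degree P \<le> size M"
    unfolding P_def
  proof (induction M)
    case (add \<mu> M)
    have "degree ([:1, - \<mu>:] * (\<Prod>\<mu>\<in>#M. [:1, - \<mu>:])) \<le> 1 + size M"
      by (rule order_trans[OF degree_mult_le]) (intro add_mono add.IH, simp)
    then show ?case by simp
  qed simp
  then have "(\<Sum>k\<le>size M. coeff P k * z ^ k) = poly P z"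
    unfolding poly_altdef by (intro sum.mono_neutral_right) (auto simp: coeff_eq_0)
  moreover have "poly P z = (\<Prod>\<mu>\<in>#M. 1 - \<mu> * z)"
    unfolding P_def by (induction M) (simp_all add: algebra_simps)
  ultimately show ?thesis
    by (simp add: newton_coeff_eq_coeff P_def)
qed

section \<open>Conjugate pairs of eigenvalues\<close>

text \<open>The link between quaternionic traces and the complex Newton theory: $T_{\mathbb H,1}(A^m)$
  is a power sum of the eigenvalues of the companion matrix, since taking companions commutes
  with powers.\<close>

lemma TH_eq_newton_coeff:
  assumes A: "A \<in> carrier_mat n n"
  shows "TH k A = newton_coeff (power_sum (proots (char_poly (companion A)))) k"
proof -
  have p: "TH1 (A ^\<^sub>m m) = power_sum (proots (char_poly (companion A))) m" for m
    using mat_trace_pow[OF companion_carrier[OF A]]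
    by (simp add: TH1_def companion_pow[OF A] power_sum_def)
  have "TH1 A = power_sum (proots (char_poly (companion A))) 1"
    using p[of 1] A by simp
  then have "k = 1 \<Longrightarrow> ?thesis"
    by (simp add: TH_def newton_coeff_1[simplified])
  moreover have "k = 0 \<Longrightarrow> ?thesis"
    by (simp add: TH_def)
  moreover have "k \<noteq> 0 \<Longrightarrow> k \<noteq> 1 \<Longrightarrow> ?thesis"
    unfolding TH_def p newton_coeff_def newton_mat_def newton_entry_def by simp
  ultimately show ?thesis by blast
qed

lemma sum_mset_pairs:
  "(\<Sum>\<mu>\<in>#(\<Sum>k<n. {#a k, b k#}). f \<mu>) = (\<Sum>k<n. f (a k) + f (b k))" for n :: nat
  by (induction n) (simp_all add: add_ac)

lemma prod_mset_pairs:
  "(\<Prod>\<mu>\<in>#(\<Sum>k<n. {#a k, b k#}). f \<mu>) = (\<Prod>k<n. f (a k) * f (b k))" for n :: nat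
  by (induction n) (simp_all add: mult_ac)

lemma size_pairs: "size (\<Sum>k<n. {#a k, b k#}) = 2 * n" for n :: nat
  by (induction n) simp_all

lemma conj_factors:
  "(1 - w * z) * (1 - cnj w * z) = 1 - complex_of_real (2 * Re w) * z + complex_of_real ((cmod w)\<^sup>2) * z\<^sup>2"
proof -
  have "(1 - w * z) * (1 - cnj w * z) = 1 - (w + cnj w) * z + (w * cnj w) * z\<^sup>2"
    by (simp add: algebra_simps power2_eq_square)
  then show ?thesis
    by (simp only: complex_add_cnj complex_norm_square)
qed

lemma conj_squares: "w\<^sup>2 + (cnj w)\<^sup>2 = complex_of_real ((2 * Re w)\<^sup>2 - 2 * (cmod w)\<^sup>2)"
  by (simp add: complex_eq_iff cmod_power2) (simp add: power2_eq_square algebra_simps)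

text \<open>This turns $p_1^2 - p_2$ into the double sum over $k < l$ in the formula for
  $T_{\mathbb H,2}$.\<close>

lemma square_sum:
  fixes r :: "nat \<Rightarrow> 'a::comm_ring_1"
  shows "(\<Sum>k<n. r k)\<^sup>2 = (\<Sum>k<n. (r k)\<^sup>2) + 2 * (\<Sum>k<n - 1. \<Sum>l = k + 1..<n. r k * r l)"
proof (induction n)
  case 0
  then show ?case by simp
next
  case (Suc n)
  have "(\<Sum>k<Suc n - 1. \<Sum>l = k + 1..<Suc n. r k * r l) =
      (\<Sum>k<n. (\<Sum>l = k + 1..<n. r k * r l) + r k * r n)"
    by (intro sum.cong) auto
  also have "\<dots> = (\<Sum>k<n - 1. \<Sum>l = k + 1..<n. r k * r l) + (\<Sum>k<n. r k) * r n"
    by (cases n) (simp_all add: sum.distrib sum_distrib_right distrib_right)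
  finally show ?case
    using Suc by (simp add: power2_eq_square algebra_simps)
qed

theorem corollary3p12:
  fixes F :: "'a::quat_right_vector_space \<Rightarrow> 'a"
    and n :: nat
    and x :: "nat \<Rightarrow> 'a"
    and x' :: "nat \<Rightarrow> 'a \<Rightarrow> quat"
    and ev :: "nat \<Rightarrow> complex"
  assumes "right_linear F"
    and "has_rank F n"
    and "\<forall>m<n. x' m \<in> dual"
    and "F = (\<lambda>v. \<Sum>m<n. (x m \<otimes>\<^sub>q x' m) v)"
    and "right_basis n x (range F)"
    and "standard_eigenvalues n (op_matrix n x x') ev"
  shows "TH 1 (op_matrix n x x') = complex_of_real (2 * Re (\<Sum>k<n. ev k))
    \<and> TH 2 (op_matrix n x x') =
        complex_of_real ((\<Sum>k<n. (cmod (ev k))\<^sup>2)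
          + 4 * (\<Sum>k<n - 1. \<Sum>l = k + 1..<n. Re (ev k) * Re (ev l)))
    \<and> (\<forall>z::complex.
        detH z (op_matrix n x x') = (\<Sum>k = 0..2 * n. (-1) ^ k * TH k (op_matrix n x x') * z ^ k)
        \<and> (\<Sum>k = 0..2 * n. (-1) ^ k * TH k (op_matrix n x x') * z ^ k) =
            (\<Prod>k<n. 1 - complex_of_real (2 * Re (ev k)) * z
                       + complex_of_real ((cmod (ev k))\<^sup>2) * z\<^sup>2))"
proof -
  define A where "A = op_matrix n x x'"
  define M where "M = (\<Sum>k<n. {#ev k, cnj (ev k)#})"
  define r where "r k = 2 * Re (ev k)" for k
  have A: "A \<in> carrier_mat n n"
    by (simp add: A_def op_matrix_def)
  have TH: "TH k A = newton_coeff (power_sum M) k" for k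
    using TH_eq_newton_coeff[OF A] assms(6) by (simp add: standard_eigenvalues_def A_def M_def)
  have p1: "power_sum M 1 = complex_of_real (\<Sum>k<n. r k)"
    unfolding power_sum_def M_def sum_mset_pairs by (simp add: complex_add_cnj r_def)
  have p2: "power_sum M 2 = complex_of_real ((\<Sum>k<n. (r k)\<^sup>2) - 2 * (\<Sum>k<n. (cmod (ev k))\<^sup>2))"
    by (simp add: power_sum_def M_def sum_mset_pairs conj_squares r_def sum_subtractf
        sum_distrib_left)
  have TH1: "TH 1 A = complex_of_real (2 * Re (\<Sum>k<n. ev k))"
    unfolding TH newton_coeff_1 p1 by (simp add: r_def sum_distrib_left)
  have "2 * TH 2 A = complex_of_real ((\<Sum>k<n. r k)\<^sup>2
      - ((\<Sum>k<n. (r k)\<^sup>2) - 2 * (\<Sum>k<n. (cmod (ev k))\<^sup>2)))"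
    unfolding TH newton_coeff_2 p1 p2 by (simp only: of_real_power of_real_diff)
  also have "\<dots> = complex_of_real (2 * ((\<Sum>k<n. (cmod (ev k))\<^sup>2)
      + (\<Sum>k<n - 1. \<Sum>l = k + 1..<n. r k * r l)))"
    unfolding square_sum[of r n] by (rule arg_cong[where f = complex_of_real]) simp
  finally have "TH 2 A = complex_of_real ((\<Sum>k<n. (cmod (ev k))\<^sup>2)
      + (\<Sum>k<n - 1. \<Sum>l = k + 1..<n. r k * r l))"
    by (simp only: of_real_mult of_real_numeral mult_cancel_left) simp
  moreover have "(\<Sum>k<n - 1. \<Sum>l = k + 1..<n. r k * r l) =
      4 * (\<Sum>k<n - 1. \<Sum>l = k + 1..<n. Re (ev k) * Re (ev l))"
    by (simp add: r_def sum_distrib_left mult_ac)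
  ultimately have TH2: "TH 2 A = complex_of_real ((\<Sum>k<n. (cmod (ev k))\<^sup>2)
      + 4 * (\<Sum>k<n - 1. \<Sum>l = k + 1..<n. Re (ev k) * Re (ev l)))"
    by (simp only:)
  have "(\<Sum>k = 0..2 * n. (-1) ^ k * TH k A * z ^ k) =
      (\<Prod>k<n. 1 - complex_of_real (2 * Re (ev k)) * z
        + complex_of_real ((cmod (ev k))\<^sup>2) * z\<^sup>2)" for z
    using sum_newton_coeff[of M z]
    by (simp only: TH M_def size_pairs prod_mset_pairs conj_factors atLeast0AtMost)
  moreover have "detH z A = (\<Sum>k = 0..2 * n. (-1) ^ k * TH k A * z ^ k)" for z
    using A by (simp add: detH_def)
  ultimately show ?thesis
    using TH1 TH2 by (simp only: A_def) blast
qed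

end
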